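(* Let $Y,S,U,\mathcal{E},C_{\mathcal{E}},A$ be as in the context. Assume that $$\mathbb{E}\exp(\lambda\|U\|_Y)<\infty\quad\text{for all }\lambda>0 .$$ Let $g:Y\to\mathbb{R}$ be a continuous function such that $|g(u)|\le a\exp(a\|u\|_Y)$ for all $u\in Y$, with some constant $a$. Let $T_n:Y\to Y$ ($n=1,2,\dots$) and $P_k:S^1\to S^1$ ($k=1,2,\dots$) be linear projections satisfying $$\lim_{n\to\infty}\|T_ny-y\|_Y=0\ \text{ for all }y\in Y,\qquad \lim_{k\to\infty}\|P_kz-z\|_{S^1}=0\ \text{ for all }z\in \mathrm{Ran}(A),$$ $$\|T_n\|_{L(Y)}\le C_0,\qquad \|P_k\|_{L(S^1)}\le C_0\qquad\text{for all }n,k,$$ with some $C_0>0$. Let $m_k,m\in S$ satisfy $\lim_{k\to\infty}m_k=m$ in $S$. Put $U_n=T_nU$. Then $$\lim_{n,k\to\infty}\mathcal{R}_{\Theta_{kn}}(g(U_n)\,|\,m_k)=\mathcal{R}_M(g(U)\,|\,m).$$ Moreover, the limit $\lim_{n\to\infty}\mathcal{R}_{\Theta_{kn}}(g(U_n)\,|\,m_k)$ exists for each fixed $k$, and the limit $\lim_{k\to\infty}\mathcal{R}_{\Theta_{kn}}(g(U_n)\,|\,m_k)$ exists for each fixed $n$.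
   Context: Setting. $(\Omega,\Sigma,\mathbb{P})$ is a complete probability space, $Y$ is a separable Banach space and $U$ is a $Y$-valued random variable. $S$ is a separable Hilbert space and $\mathcal{E}$ is an $S$-valued Gaussian random variable, independent of $U$, with $\mathbb{E}\mathcal{E}=0$ and covariance operator $C_{\mathcal{E}}:S\to S$, i.e. $\mathbb{E}(\langle s_1,\mathcal{E}\rangle_S\langle\mathcal{E},s_2\rangle_S)=\langle s_1,C_{\mathcal{E}}s_2\rangle_S$. The essential range of $\mathcal{E}$ is dense in $S$, so $C_{\mathcal{E}}$ is one-to-one, self-adjoint, positive and trace class. For $t\ge 0$, $S^t:=C_{\mathcal{E}}^tS$ with norm $\|C_{\mathcal{E}}^tu\|_{S^t}:=\|u\|_S$, and $Z:=S^{1/2}$ (the Cameron–Martin space of $\mathcal{E}$), so $\|z\|_Z=\|C_{\mathcal{E}}^{-1/2}z\|_S$. $A:Y\to S^1$ is a bounded linear operator. $L(X)$ denotes the bounded linear operators on $X$. Reconstructors. For a $Y$-valued random variable $V$ with distribution $\lambda_V$, a bounded linear operator $B:Y\to S^1$, a measurement model $N=BV+\mathcal{E}$ and $m\in S$, the reconstructor is $$\mathcal{R}_N(g(V)\,|\,m)=\frac{\int_Y g(u)\exp\left(-\tfrac12\|Bu\|_Z^2+\langle C_{\mathcal{E}}^{-1}Bu,m\rangle_S\right)d\lambda_V(u)}{\int_Y \exp\left(-\tfrac12\|Bu\|_Z^2+\langle C_{\mathcal{E}}^{-1}Bu,m\rangle_S\right)d\lambda_V(u)} .$$ The models used are $M=AU+\mathcal{E}$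 and $\Theta_{kn}=P_kAU_n+\mathcal{E}$. *)

theory Defs
  imports "HOL-Probability.Probability"
begin

text \<open>
  Degenerate (Dirac) laws are Gaussian; they have to be listed separately because
  \<^const>\<open>normal_density\<close> with zero standard deviation is the zero function.
\<close>

definition gaussian_law :: "real measure \<Rightarrow> bool" where
  "gaussian_law \<mu> \<longleftrightarrow>
     (\<exists>a. \<mu> = return borel a) \<or>
     (\<exists>a \<sigma>. \<sigma> > 0 \<and> \<mu> = density lborel (\<lambda>x. ennreal (normal_density a \<sigma> x)))"

definition gaussian_rv :: "'w measure \<Rightarrow> ('w \<Rightarrow> 's::real_inner) \<Rightarrow> bool" where
  "gaussian_rv M X \<longleftrightarrow>
     X \<in> borel_measurable M \<and>
     (\<forall>s. gaussian_law (distr M borel (\<lambda>\<omega>. s \<bullet> X \<omega>)))"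

definition covariance_operator ::
    "'w measure \<Rightarrow> ('w \<Rightarrow> 's::real_inner) \<Rightarrow> ('s \<Rightarrow> 's) \<Rightarrow> bool" where
  "covariance_operator M X C \<longleftrightarrow>
     bounded_linear C \<and>
     (\<forall>s1 s2. (\<integral>\<omega>. (s1 \<bullet> X \<omega>) * (X \<omega> \<bullet> s2) \<partial>M) = s1 \<bullet> C s2)"

definition essential_range :: "'w measure \<Rightarrow> ('w \<Rightarrow> 's::topological_space) \<Rightarrow> 's set" where
  "essential_range M X =
     {s. \<forall>V. open V \<and> s \<in> V \<longrightarrow> measure M (X -` V \<inter> space M) > 0}"

text \<open>
  Independence of two random variables with values in different types:
  \<^const>\<open>prob_space.indep_var\<close> only covers two variables of the same type, so independence
  is expressed for the generated sigma-algebras.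
\<close>

definition independent_rvs ::
    "'w measure \<Rightarrow> ('w \<Rightarrow> 'a::topological_space) \<Rightarrow> ('w \<Rightarrow> 'b::topological_space) \<Rightarrow> bool" where
  "independent_rvs M X Y \<longleftrightarrow>
     prob_space.indep_set M
       (sets (vimage_algebra (space M) X borel))
       (sets (vimage_algebra (space M) Y borel))"

definition positive_operator :: "('s::real_inner \<Rightarrow> 's) \<Rightarrow> bool" where
  "positive_operator R \<longleftrightarrow>
     bounded_linear R \<and> (\<forall>x y. R x \<bullet> y = x \<bullet> R y) \<and> (\<forall>x. x \<bullet> R x \<ge> 0)"

text \<open>
  The power $C^{1/2}$. On a Hilbert space a positive operator has exactly one positive
  square root.
\<close>

definition op_sqrt :: "('s::real_inner \<Rightarrow> 's) \<Rightarrow> ('s \<Rightarrow> 's)" where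
  "op_sqrt C = (THE R. positive_operator R \<and> R \<circ> R = C)"

text \<open>
  For an injective operator \<open>D\<close>, the space $DS$ with norm $\|Du\| := \|u\|$ has carrier
  \<open>range D\<close> and norm \<open>ran_norm D\<close> (only meaningful on \<open>range D\<close>). Thus
  $S^1$ is given by \<open>D = C\<close> and $Z = S^{1/2}$ by \<open>D = op_sqrt C\<close>.
\<close>

definition ran_norm :: "('s::real_normed_vector \<Rightarrow> 's) \<Rightarrow> 's \<Rightarrow> real" where
  "ran_norm D z = norm (inv D z)"

definition bounded_linear_into_ran ::
    "('s::real_normed_vector \<Rightarrow> 's) \<Rightarrow> ('y::real_normed_vector \<Rightarrow> 's) \<Rightarrow> bool" where
  "bounded_linear_into_ran D B \<longleftrightarrow>
     linear B \<and> range B \<subseteq> range D \<and> (\<exists>K. \<forall>y. ran_norm D (B y) \<le> K * norm y)"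

definition bounded_linear_on_ran ::
    "('s::real_normed_vector \<Rightarrow> 's) \<Rightarrow> ('s \<Rightarrow> 's) \<Rightarrow> bool" where
  "bounded_linear_on_ran D P \<longleftrightarrow>
     P ` range D \<subseteq> range D \<and>
     (\<forall>x\<in>range D. \<forall>y\<in>range D. P (x + y) = P x + P y) \<and>
     (\<forall>c. \<forall>x\<in>range D. P (c *\<^sub>R x) = c *\<^sub>R P x) \<and>
     (\<exists>K. \<forall>x\<in>range D. ran_norm D (P x) \<le> K * ran_norm D x)"

text \<open>The operator norm on the space $DS$, in the same form as \<^const>\<open>onorm\<close>.\<close>

definition ran_onorm :: "('s::real_normed_vector \<Rightarrow> 's) \<Rightarrow> ('s \<Rightarrow> 's) \<Rightarrow> real" where
  "ran_onorm D P = (SUP x\<in>range D. ran_norm D (P x) / ran_norm D x)"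

definition likelihood ::
    "('s::real_inner \<Rightarrow> 's) \<Rightarrow> ('y \<Rightarrow> 's) \<Rightarrow> 's \<Rightarrow> 'y \<Rightarrow> real" where
  "likelihood C B m u =
     exp (- (1 / 2) * (ran_norm (op_sqrt C) (B u))\<^sup>2 + inv C (B u) \<bullet> m)"

text \<open>
  \<open>reconstructor M C B V g m\<close> is $\mathcal{R}_N(g(V)\,|\,m)$ for the measurement model
  $N = BV + \mathcal{E}$, where \<open>C\<close> is the covariance operator of the noise $\mathcal{E}$.
\<close>

definition reconstructor ::
    "'w measure \<Rightarrow> ('s::real_inner \<Rightarrow> 's) \<Rightarrow> ('y::topological_space \<Rightarrow> 's) \<Rightarrow> ('w \<Rightarrow> 'y) \<Rightarrow>
     ('y \<Rightarrow> real) \<Rightarrow> 's \<Rightarrow> real" where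
  "reconstructor M C B V g m =
     (\<integral>u. g u * likelihood C B m u \<partial>(distr M borel V)) /
     (\<integral>u. likelihood C B m u \<partial>(distr M borel V))"

end

theory Submission
  imports Defs
begin

text \<open>
  Writing $x = C^{-1}Bu$, the exponent of the likelihood is
  $-\frac12\langle x, Cx\rangle + \langle x, m\rangle$, so it is bounded above by
  $\|x\|\,\|m\|$, which is linear in $\|u\|$. Hence along every sequence of indices the
  numerators and denominators are dominated by a multiple of $\exp(\lambda\|U\|)$ for one
  \<open>\<lambda>\<close>, and dominated convergence gives all three limits. A double limit
  reduces to limits along sequences $(p_j, q_j)$ with $p_j, q_j \to \infty$.

  The likelihood is defined through $C^{1/2}$, so the unique positive square root has to be
  constructed; after scaling, it is the binomial series
  $(I - B)^{1/2} = \sum_n c_n B^n$ for a self-adjoint contraction \<open>B\<close>.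
\<close>

section \<open>Coefficients of the binomial series of the square root\<close>

text \<open>The coefficient of \<open>t^n\<close> in \<open>(1 - t)^(1/2)\<close>, an instance of
  the series of \<open>(1 - t)^(-r)\<close> with coefficients
  \<open>pochhammer r n / fact n\<close>.\<close>

definition sqrt_coeff :: "nat \<Rightarrow> real" where
  "sqrt_coeff n = pochhammer (- 1 / 2) n / fact n"

lemma sqrt_coeff_0 [simp]: "sqrt_coeff 0 = 1"
  by (simp add: sqrt_coeff_def)

lemma sqrt_coeff_Suc_nonpos: "sqrt_coeff (Suc n) \<le> 0"
proof -
  have "pochhammer (1 / 2 :: real) n \<ge> 0" by (rule pochhammer_nonneg) simp
  then show ?thesis by (simp add: sqrt_coeff_def pochhammer_rec divide_nonpos_pos)
qed

text \<open>Partial sums are the coefficients after division by \<open>1 - t\<close>, hence those of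
  \<open>(1 - t)^(-1/2)\<close>, which are visibly nonnegative. This sign gives both summability and
  positivity of the root.\<close>

lemma sum_sqrt_coeff: "(\<Sum>k\<le>n. sqrt_coeff k) = pochhammer (1 / 2) n / fact n"
proof (induction n)
  case (Suc n)
  have c: "sqrt_coeff (Suc n) = - (1 / 2) * pochhammer (1 / 2) n / fact (Suc n)"
    by (simp add: sqrt_coeff_def pochhammer_rec[of "- (1 / 2)"])
  show ?case
    unfolding sum.atMost_Suc Suc c pochhammer_Suc[of "1 / 2" n] fact_Suc
    by (simp add: divide_simps) (simp add: algebra_simps)
qed (simp add: sqrt_coeff_def)

lemma sum_sqrt_coeff_nonneg: "(\<Sum>k\<le>n. sqrt_coeff k) \<ge> 0"
  unfolding sum_sqrt_coeff by (intro divide_nonneg_pos pochhammer_nonneg) auto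

text \<open>Only the coefficient at 0 is positive, with value 1; all other signs flip. Nonnegative
  partial sums then bound the absolute sums by 2.\<close>

lemma sum_abs_sqrt_coeff: "(\<Sum>k\<le>n. \<bar>sqrt_coeff k\<bar>) = 2 - (\<Sum>k\<le>n. sqrt_coeff k)"
proof (induction n)
  case (Suc n)
  then show ?case using sqrt_coeff_Suc_nonpos[of n] by simp
qed simp

lemma summable_abs_sqrt_coeff: "summable (\<lambda>n. \<bar>sqrt_coeff n\<bar>)"
proof (rule summableI_nonneg_bounded[where x = 2])
  fix n
  have "(\<Sum>k<n. \<bar>sqrt_coeff k\<bar>) \<le> (\<Sum>k\<le>n. \<bar>sqrt_coeff k\<bar>)"
    by (rule sum_mono2) auto
  also have "\<dots> \<le> 2" unfolding sum_abs_sqrt_coeff using sum_sqrt_coeff_nonneg[of n] by simp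
  finally show "(\<Sum>k<n. \<bar>sqrt_coeff k\<bar>) \<le> 2" .
qed simp

text \<open>The square of \<open>(1 - t)^(1/2)\<close> is \<open>1 - t\<close>. Vandermonde's
  identity for rising factorials reduces the sum to \<open>pochhammer (- 1) n\<close>, which
  contains the factor 0 once \<open>n\<close> is at least 2.\<close>

lemma sqrt_coeff_convolution:
  "(\<Sum>k\<le>n. sqrt_coeff k * sqrt_coeff (n - k)) = (if n = 0 then 1 else if n = 1 then - 1 else 0)"
proof -
  have "(\<Sum>k\<le>n. sqrt_coeff k * sqrt_coeff (n - k)) =
      (\<Sum>k\<le>n. real (n choose k) * pochhammer (- 1 / 2) k * pochhammer (- 1 / 2) (n - k)) / fact n"
    unfolding sum_divide_distrib
    by (rule sum.cong) (auto simp: sqrt_coeff_def binomial_fact)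
  also have "\<dots> = pochhammer (- 1) n / fact n"
    using pochhammer_binomial_sum[of "- 1 / 2 :: real" "- 1 / 2" n] by simp
  also have "\<dots> = (if n = 0 then 1 else if n = 1 then - 1 else 0)"
    using pochhammer_of_nat_eq_0_lemma[of 1 n, where 'a = real] by (cases n) (auto simp: not_less_eq)
  finally show ?thesis .
qed

section \<open>Cauchy products and the binomial series of a contraction\<close>

text \<open>Absolute summability over all pairs permits regrouping along the diagonals
  \<open>i + j = n\<close>, where the vector is constant. With \<open>v n = (B ^^ n) x\<close> this
  multiplies operator power series.\<close>

lemma Cauchy_product_scaleR_infsum:
  fixes c d :: "nat \<Rightarrow> real" and v :: "nat \<Rightarrow> 'a::banach"
  assumes c: "summable (\<lambda>n. \<bar>c n\<bar>)" and d: "summable (\<lambda>n. \<bar>d n\<bar>)" and v: "\<And>n. norm (v n) \<le> K"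
  shows "(\<Sum>\<^sub>\<infinity>i. \<Sum>\<^sub>\<infinity>j. (c i * d j) *\<^sub>R v (i + j)) = (\<Sum>\<^sub>\<infinity>n. (\<Sum>k\<le>n. c k * d (n - k)) *\<^sub>R v n)"
proof -
  define f where "f = (\<lambda>(i, j). (c i * d j) *\<^sub>R v (i + j))"
  have cs: "(\<lambda>n. norm (c n)) summable_on UNIV" and ds: "(\<lambda>n. norm (d n)) summable_on UNIV"
    using c d by (auto intro!: norm_summable_imp_summable_on)
  have "(\<lambda>x. norm (case x of (i, j) \<Rightarrow> c i * d j)) summable_on UNIV \<times> UNIV"
    by (rule Infinite_Sum.abs_summable_on_Sigma_iff[THEN iffD2])
      (use cs ds in \<open>auto simp: abs_mult infsum_cmult_right' infsum_nonneg
        intro!: summable_on_cmult_right summable_on_cmult_left\<close>)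
  then have "(\<lambda>x. norm (case x of (i, j) \<Rightarrow> c i * d j) * K) summable_on UNIV \<times> UNIV"
    by (rule summable_on_cmult_left)
  moreover have "norm (f x) \<le> norm (case x of (i, j) \<Rightarrow> c i * d j) * K" for x
    by (auto simp: f_def abs_mult split: prod.split intro!: mult_left_mono v)
  moreover have "0 \<le> norm (case x of (i, j) \<Rightarrow> c i * d j) * K" for x
    by (intro mult_nonneg_nonneg norm_ge_zero order_trans[OF norm_ge_zero v])
  ultimately have f: "f summable_on UNIV \<times> UNIV"
    by (intro abs_summable_summable[where f = f]) (rule summable_on_comparison_test, auto)
  \<comment> \<open>Lists the pairs diagonal by diagonal; the truncated subtraction is exact because
    \<open>k\<close> runs over \<open>{..n}\<close>.\<close>
  define h :: "nat \<times> nat \<Rightarrow> nat \<times> nat" where "h = (\<lambda>(n, k). (k, n - k))"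
  have h: "bij_betw h (SIGMA n:UNIV. {..n}) (UNIV \<times> UNIV)"
    by (rule bij_betw_byWitness[where f' = "\<lambda>(i, j). (i + j, i)"]) (auto simp: h_def)
  have fh: "(\<lambda>x. f (h x)) summable_on (SIGMA n:UNIV. {..n})"
    using summable_on_reindex_bij_betw[OF h, of f] f by simp
  have "(\<Sum>\<^sub>\<infinity>i. \<Sum>\<^sub>\<infinity>j. f (i, j)) = infsum f (UNIV \<times> UNIV)"
    by (rule infsum_Sigma_banach[OF f])
  also have "\<dots> = infsum (\<lambda>x. f (h x)) (SIGMA n:UNIV. {..n})"
    by (rule infsum_reindex_bij_betw[OF h, symmetric])
  also have "\<dots> = (\<Sum>\<^sub>\<infinity>n. \<Sum>\<^sub>\<infinity>k\<in>{..n}. f (h (n, k)))"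
    by (rule infsum_Sigma_banach[OF fh, symmetric])
  also have "\<dots> = (\<Sum>\<^sub>\<infinity>n. (\<Sum>k\<le>n. c k * d (n - k)) *\<^sub>R v n)"
    by (auto simp: h_def f_def scaleR_sum_left intro!: infsum_cong sum.cong)
  finally show ?thesis by (simp add: f_def)
qed

lemma bounded_linear_funpow:
  assumes "bounded_linear (B :: 'a::real_normed_vector \<Rightarrow> 'a)"
  shows "bounded_linear (B ^^ n)"
  by (induction n) (auto simp: id_def o_def bounded_linear_ident assms intro: bounded_linear_compose)

lemma norm_funpow_contraction_le:
  fixes B :: "'a::real_normed_vector \<Rightarrow> 'a"
  assumes "\<And>x. norm (B x) \<le> norm x"
  shows "norm ((B ^^ n) x) \<le> norm x"
  by (induction n) (simp_all add: order_trans[OF assms])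

lemma funpow_self_adjoint:
  fixes B :: "'a::real_inner \<Rightarrow> 'a"
  assumes "\<And>x y. B x \<bullet> y = x \<bullet> B y"
  shows "(B ^^ n) x \<bullet> y = x \<bullet> (B ^^ n) y"
  by (induction n arbitrary: x y) (simp_all add: assms flip: funpow_swap1)

text \<open>The operator \<open>(I - B)^(1/2)\<close>, summed pointwise. Since \<open>infsum\<close>
  is 0 for a family that is not summable, the formula is meaningful where the series converges, as
  it does for contractions.\<close>

definition binomial_root :: "('a::banach \<Rightarrow> 'a) \<Rightarrow> 'a \<Rightarrow> 'a" where
  "binomial_root B x = (\<Sum>\<^sub>\<infinity>n. sqrt_coeff n *\<^sub>R (B ^^ n) x)"

lemma binomial_root_has_sum:
  fixes B :: "'a::banach \<Rightarrow> 'a"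
  assumes "\<And>x. norm (B x) \<le> norm x"
  shows "((\<lambda>n. sqrt_coeff n *\<^sub>R (B ^^ n) x) has_sum binomial_root B x) UNIV"
    and "norm (binomial_root B x) \<le> (\<Sum>n. \<bar>sqrt_coeff n\<bar>) * norm x"
proof -
  have le: "norm (sqrt_coeff n *\<^sub>R (B ^^ n) x) \<le> \<bar>sqrt_coeff n\<bar> * norm x" for n
    using norm_funpow_contraction_le[of B n x, OF assms] by (simp add: mult_left_mono)
  have s: "summable (\<lambda>n. \<bar>sqrt_coeff n\<bar> * norm x)"
    by (intro summable_mult2 summable_abs_sqrt_coeff)
  have ns: "summable (\<lambda>n. norm (sqrt_coeff n *\<^sub>R (B ^^ n) x))"
    by (rule summable_comparison_test'[OF s, of 0]) (use le in simp)
  then show *: "((\<lambda>n. sqrt_coeff n *\<^sub>R (B ^^ n) x) has_sum binomial_root B x) UNIV"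
    unfolding binomial_root_def by (intro has_sum_infsum norm_summable_imp_summable_on)
  have "binomial_root B x = (\<Sum>n. sqrt_coeff n *\<^sub>R (B ^^ n) x)"
    using has_sum_imp_sums[OF *] by (simp add: sums_iff)
  also have "norm \<dots> \<le> (\<Sum>n. norm (sqrt_coeff n *\<^sub>R (B ^^ n) x))"
    by (rule summable_norm[OF ns])
  also have "\<dots> \<le> (\<Sum>n. \<bar>sqrt_coeff n\<bar> * norm x)"
    by (rule suminf_le[OF le ns s])
  finally show "norm (binomial_root B x) \<le> (\<Sum>n. \<bar>sqrt_coeff n\<bar>) * norm x"
    using suminf_mult2[OF summable_abs_sqrt_coeff, of "norm x"] by simp
qed

lemma bounded_linear_binomial_root:
  fixes B :: "'a::banach \<Rightarrow> 'a"
  assumes B: "bounded_linear B" and le: "\<And>x. norm (B x) \<le> norm x"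
  shows "bounded_linear (binomial_root B)"
proof (rule bounded_linear_intro)
  interpret Bn: bounded_linear "B ^^ n" for n by (rule bounded_linear_funpow[OF B])
  note hs = binomial_root_has_sum(1)[of B, OF le]
  show "binomial_root B (x + y) = binomial_root B x + binomial_root B y" for x y
    by (rule has_sum_unique[OF hs])
      (use has_sum_add[OF hs[of x] hs[of y]] in \<open>simp add: Bn.add scaleR_add_right\<close>)
  show "binomial_root B (r *\<^sub>R x) = r *\<^sub>R binomial_root B x" for r x
    by (rule has_sum_unique[OF hs])
      (use has_sum_bounded_linear[OF bounded_linear_scaleR_right[of r] hs[of x]]
        in \<open>simp add: Bn.scaleR mult.commute\<close>)
  show "norm (binomial_root B x) \<le> norm x * (\<Sum>n. \<bar>sqrt_coeff n\<bar>)" for x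
    using binomial_root_has_sum(2)[of B x, OF le] by (simp add: mult.commute)
qed

text \<open>\<open>Q\<close> passes through the series by continuity and past each power by
  \<open>QB\<close>. Uniqueness of the square root rests on this.\<close>

lemma binomial_root_commute:
  fixes B Q :: "'a::banach \<Rightarrow> 'a"
  assumes "bounded_linear Q" and le: "\<And>x. norm (B x) \<le> norm x" and QB: "\<And>x. Q (B x) = B (Q x)"
  shows "Q (binomial_root B x) = binomial_root B (Q x)"
proof -
  interpret Q: bounded_linear Q by fact
  have "Q ((B ^^ n) x) = (B ^^ n) (Q x)" for n
    by (induction n) (auto simp: QB)
  then have "((\<lambda>n. sqrt_coeff n *\<^sub>R (B ^^ n) (Q x)) has_sum Q (binomial_root B x)) UNIV"
    using has_sum_bounded_linear[OF assms(1) binomial_root_has_sum(1)[of B x, OF le]]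
    by (simp add: Q.scaleR)
  then show ?thesis
    by (rule has_sum_unique) (rule binomial_root_has_sum(1)[OF le])
qed

text \<open>Applying the series twice gives a double series in \<open>(B ^^ (i + j)) x\<close>. In
  its Cauchy product only the diagonals 0 and 1 survive, contributing \<open>x\<close> and
  \<open>- B x\<close>.\<close>

lemma binomial_root_square:
  fixes B :: "'a::banach \<Rightarrow> 'a"
  assumes B: "bounded_linear B" and le: "\<And>x. norm (B x) \<le> norm x"
  shows "binomial_root B (binomial_root B x) = x - B x"
proof -
  note hs = binomial_root_has_sum(1)[of B, OF le]
  have "sqrt_coeff i *\<^sub>R (B ^^ i) (binomial_root B x) =
      (\<Sum>\<^sub>\<infinity>j. (sqrt_coeff i * sqrt_coeff j) *\<^sub>R (B ^^ (i + j)) x)" for i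
  proof -
    interpret Bi: bounded_linear "B ^^ i" by (rule bounded_linear_funpow[OF B])
    have "((\<lambda>j. sqrt_coeff i *\<^sub>R (B ^^ i) (sqrt_coeff j *\<^sub>R (B ^^ j) x)) has_sum
        sqrt_coeff i *\<^sub>R (B ^^ i) (binomial_root B x)) UNIV"
      by (intro has_sum_bounded_linear[OF bounded_linear_scaleR_right]
          has_sum_bounded_linear[OF Bi.bounded_linear_axioms] hs)
    then show ?thesis by (simp add: Bi.scaleR funpow_add infsumI)
  qed
  then have "binomial_root B (binomial_root B x) =
      (\<Sum>\<^sub>\<infinity>i. \<Sum>\<^sub>\<infinity>j. (sqrt_coeff i * sqrt_coeff j) *\<^sub>R (B ^^ (i + j)) x)"
    by (simp add: binomial_root_def[of B "binomial_root B x"])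
  also have "\<dots> = (\<Sum>\<^sub>\<infinity>n. (\<Sum>k\<le>n. sqrt_coeff k * sqrt_coeff (n - k)) *\<^sub>R (B ^^ n) x)"
    by (rule Cauchy_product_scaleR_infsum[OF summable_abs_sqrt_coeff summable_abs_sqrt_coeff
          norm_funpow_contraction_le[OF le]])
  also have "\<dots> = (\<Sum>\<^sub>\<infinity>n\<in>{0, 1}. (\<Sum>k\<le>n. sqrt_coeff k * sqrt_coeff (n - k)) *\<^sub>R (B ^^ n) x)"
    by (rule infsum_cong_neutral) (auto simp: sqrt_coeff_convolution)
  also have "\<dots> = x - B x"
    by (simp add: sqrt_coeff_convolution del: sum.atMost_Suc)
  finally show ?thesis .
qed

lemma positive_binomial_root:
  fixes B :: "'a::{real_inner, banach} \<Rightarrow> 'a"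
  assumes B: "bounded_linear B" and le: "\<And>x. norm (B x) \<le> norm x"
    and sa: "\<And>x y. B x \<bullet> y = x \<bullet> B y"
  shows "positive_operator (binomial_root B)"
  unfolding positive_operator_def
proof (intro conjI allI)
  note hs = binomial_root_has_sum(1)[of B, OF le]
  show "bounded_linear (binomial_root B)" by (rule bounded_linear_binomial_root[OF B le])
  have l: "((\<lambda>n. sqrt_coeff n * ((B ^^ n) x \<bullet> y)) has_sum binomial_root B x \<bullet> y) UNIV" for x y
    using has_sum_bounded_linear[OF bounded_linear_inner_left[of y] hs[of x]] by simp
  have r: "((\<lambda>n. sqrt_coeff n * (x \<bullet> (B ^^ n) y)) has_sum x \<bullet> binomial_root B y) UNIV" for x y
    using has_sum_bounded_linear[OF bounded_linear_inner_right[of x] hs[of y]] by simp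
  show "binomial_root B x \<bullet> y = x \<bullet> binomial_root B y" for x y
    using has_sum_unique[OF l[of x y]] r[of x y] by (simp add: funpow_self_adjoint[OF sa])
  show "0 \<le> x \<bullet> binomial_root B x" for x
  proof -
    have "(\<lambda>n. \<Sum>k\<le>n. sqrt_coeff k * (x \<bullet> (B ^^ k) x)) \<longlonglongrightarrow> x \<bullet> binomial_root B x"
      using has_sum_imp_sums[OF r[of x x]] by (simp add: sums_def_le)
    moreover have "0 \<le> (\<Sum>k\<le>n. sqrt_coeff k * (x \<bullet> (B ^^ k) x))" for n
    proof -
      \<comment> \<open>For \<open>k > 0\<close> the coefficient is nonpositive and
        \<open>x \<bullet> (B ^^ k) x\<close> is at most \<open>x \<bullet> x\<close>, so this
        replacement only lowers the sum, to a nonnegative partial coefficient sum times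
        \<open>x \<bullet> x\<close>.\<close>
      have "sqrt_coeff k * (x \<bullet> x) \<le> sqrt_coeff k * (x \<bullet> (B ^^ k) x)" for k
      proof (cases k)
        case (Suc j)
        have "x \<bullet> (B ^^ k) x \<le> norm x * norm ((B ^^ k) x)" by (rule norm_cauchy_schwarz)
        also have "\<dots> \<le> norm x * norm x"
          by (intro mult_left_mono norm_funpow_contraction_le le) auto
        finally have "x \<bullet> (B ^^ k) x \<le> x \<bullet> x" by (simp add: power2_norm_eq_inner flip: power2_eq_square)
        then show ?thesis using sqrt_coeff_Suc_nonpos[of j] Suc by (simp add: mult_left_mono_neg)
      qed simp
      then have "(\<Sum>k\<le>n. sqrt_coeff k * (x \<bullet> x)) \<le> (\<Sum>k\<le>n. sqrt_coeff k * (x \<bullet> (B ^^ k) x))"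
        by (intro sum_mono) auto
      moreover have "0 \<le> (\<Sum>k\<le>n. sqrt_coeff k * (x \<bullet> x))"
        unfolding sum_distrib_right[symmetric] using sum_sqrt_coeff_nonneg by simp
      ultimately show ?thesis by simp
    qed
    ultimately show ?thesis by (intro LIMSEQ_le_const) auto
  qed
qed

section \<open>Positive operators and their unique positive square root\<close>

text \<open>The discriminant argument for the quadratic form at \<open>t *\<^sub>R x + y\<close>.
  The form may be degenerate, so a vanishing leading coefficient is a separate case.\<close>

lemma positive_operator_Cauchy_Schwarz:
  assumes "positive_operator R"
  shows "(x \<bullet> R y)\<^sup>2 \<le> (x \<bullet> R x) * (y \<bullet> R y)"
proof -
  interpret R: bounded_linear R using assms by (simp add: positive_operator_def)
  have sa: "y \<bullet> R x = x \<bullet> R y" 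
    using assms by (metis positive_operator_def inner_commute)
  have pos: "z \<bullet> R z \<ge> 0" for z using assms by (simp add: positive_operator_def)
  have q: "0 \<le> t\<^sup>2 * (x \<bullet> R x) + 2 * t * (x \<bullet> R y) + y \<bullet> R y" for t
    using pos[of "t *\<^sub>R x + y"] sa
    by (simp add: R.add R.scaleR inner_add algebra_simps power2_eq_square)
  show ?thesis
  proof (cases "x \<bullet> R x = 0")
    case True
    have "x \<bullet> R y = 0"
    proof (rule ccontr)
      assume "x \<bullet> R y \<noteq> 0"
      \<comment> \<open>The quadratic is affine in \<open>t\<close> here, and this \<open>t\<close>
        gives it the value -1.\<close>
      with q[of "- (y \<bullet> R y + 1) / (2 * (x \<bullet> R y))"] True show False by (simp add: field_simps)
    qed
    then show ?thesis using True by simp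
  next
    case False
    then have p: "x \<bullet> R x > 0" using pos[of x] by simp
    \<comment> \<open>The minimizer of the quadratic.\<close>
    show ?thesis using q[of "- (x \<bullet> R y) / (x \<bullet> R x)"] p
      by (simp add: field_simps power2_eq_square)
  qed
qed

text \<open>Cauchy-Schwarz for the pair \<open>R x\<close>, \<open>x\<close> bounds
  \<open>(R x \<bullet> R x)\<^sup>2\<close> by a product with the factor
  \<open>x \<bullet> R x\<close>.\<close>

lemma positive_operator_eq_0:
  assumes "positive_operator R" and "x \<bullet> R x = 0"
  shows "R x = 0"
  using positive_operator_Cauchy_Schwarz[OF assms(1), of "R x" x] assms(2) by simp

text \<open>The same pairing, with \<open>le\<close> applied at \<open>R x\<close> and at
  \<open>x\<close>, bounds the fourth power of \<open>norm (R x)\<close> by the product of the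
  squares of \<open>norm (R x)\<close> and \<open>norm x\<close>; a nonzero \<open>R x\<close>
  cancels.\<close>

lemma positive_operator_contraction:
  assumes R: "positive_operator R" and le: "\<And>x. x \<bullet> R x \<le> x \<bullet> x"
  shows "norm (R x) \<le> norm x"
proof (cases "R x = 0")
  case False
  have "((R x) \<bullet> R x)\<^sup>2 \<le> (R x \<bullet> R (R x)) * (x \<bullet> R x)"
    by (rule positive_operator_Cauchy_Schwarz[OF R])
  also have "\<dots> \<le> (R x \<bullet> R x) * (x \<bullet> x)"
    by (intro mult_mono le inner_ge_zero) (use R in \<open>simp add: positive_operator_def\<close>)
  finally have "R x \<bullet> R x \<le> x \<bullet> x" using False by (simp add: power2_eq_square)
  then show ?thesis by (simp add: norm_le)
qed simp

text \<open>For existence, scale \<open>C\<close> by a norm bound \<open>c\<close> and take the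
  binomial root of \<open>B = I - C / c\<close>. For uniqueness, any positive root commutes with
  \<open>C\<close>, hence with the constructed one, so the difference of squares factors.\<close>

lemma positive_sqrt_unique_exists:
  fixes C :: "'s::{real_inner, banach} \<Rightarrow> 's"
  assumes C: "positive_operator C"
  shows "\<exists>!R. positive_operator R \<and> R \<circ> R = C"
proof -
  interpret C: bounded_linear C using C by (simp add: positive_operator_def)
  have Csa: "C x \<bullet> y = x \<bullet> C y" and Cpos: "0 \<le> x \<bullet> C x" for x y
    using C by (auto simp: positive_operator_def)
  obtain c where c: "c > 0" "\<And>x. norm (C x) \<le> norm x * c" using C.pos_bounded by blast
  define B where "B x = x - (1 / c) *\<^sub>R C x" for x
  have B: "bounded_linear B" unfolding B_def
    by (intro bounded_linear_sub bounded_linear_ident bounded_linear_scaleR_right[THEN bounded_linear_compose] C.bounded_linear_axioms)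
  have Bsa: "B x \<bullet> y = x \<bullet> B y" for x y
    by (simp add: B_def inner_diff Csa)
  have Bpos: "0 \<le> x \<bullet> B x" for x
  proof -
    have "x \<bullet> C x \<le> norm x * (norm x * c)"
      using norm_cauchy_schwarz[of x "C x"] mult_left_mono[OF c(2)[of x], of "norm x"] by simp
    then have "x \<bullet> C x \<le> c * (x \<bullet> x)" by (simp add: power2_eq_square mult_ac flip: power2_norm_eq_inner)
    then show ?thesis using c(1) by (simp add: B_def inner_diff field_simps)
  qed
  have "positive_operator B" using B Bsa Bpos by (auto simp: positive_operator_def)
  \<comment> \<open>Positivity of \<open>C\<close> puts the form of \<open>B\<close> below that of
    the identity.\<close>
  then have Ble: "norm (B x) \<le> norm x" for x
    by (rule positive_operator_contraction) (use Cpos c(1) in \<open>simp add: B_def inner_diff\<close>)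
  define R where "R x = sqrt c *\<^sub>R binomial_root B x" for x
  have br: "positive_operator (binomial_root B)" by (rule positive_binomial_root[OF B Ble Bsa])
  then interpret br: bounded_linear "binomial_root B" by (simp add: positive_operator_def)
  have R: "positive_operator R"
    using br c(1) unfolding positive_operator_def R_def
    by (auto intro!: bounded_linear_scaleR_right[THEN bounded_linear_compose])
  have RR: "R (R x) = C x" for x
  proof -
    have "R (R x) = c *\<^sub>R binomial_root B (binomial_root B x)"
      using c(1) by (simp add: R_def br.scaleR)
    also have "\<dots> = C x" using c(1) by (simp add: binomial_root_square[OF B Ble]) (simp add: B_def)
    finally show ?thesis .
  qed
  show ?thesis
  proof (rule ex1I[of _ R])
    show "positive_operator R \<and> R \<circ> R = C" using R RR by auto
    fix Q assume "positive_operator Q \<and> Q \<circ> Q = C"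
    then have Q: "positive_operator Q" and QQ: "Q (Q x) = C x" for x by (auto simp: fun_eq_iff)
    interpret Q: bounded_linear Q using Q by (simp add: positive_operator_def)
    interpret R: bounded_linear R using R by (simp add: positive_operator_def)
    have "Q (C x) = C (Q x)" for x by (simp flip: QQ)
    then have QB: "Q (B x) = B (Q x)" for x by (simp add: B_def Q.diff Q.scaleR)
    have QR: "Q (R x) = R (Q x)" for x
      by (simp add: R_def Q.scaleR binomial_root_commute[OF Q.bounded_linear_axioms Ble QB])
    show "Q = R"
    proof
      fix x
      define y where "y = Q x - R x"
      \<comment> \<open>Commutation gives \<open>(Q + R) (Q - R) x = Q (Q x) - R (R x) = 0\<close>,
        so two nonnegative terms sum to 0.\<close>
      have "y \<bullet> Q y + y \<bullet> R y = 0"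
        by (simp add: y_def Q.diff R.diff QR QQ RR flip: inner_add_right)
      moreover have "y \<bullet> Q y \<ge> 0" "y \<bullet> R y \<ge> 0" using Q R by (auto simp: positive_operator_def)
      ultimately have "Q y = 0" "R y = 0"
        using positive_operator_eq_0[OF Q, of y] positive_operator_eq_0[OF R, of y] by auto
      moreover have "y \<bullet> y = Q y \<bullet> x - R y \<bullet> x"
        using Q R by (simp add: positive_operator_def) (simp add: y_def inner_diff_right)
      ultimately show "Q x = R x" by (simp add: y_def)
    qed
  qed
qed

lemma op_sqrt:
  fixes C :: "'s::{real_inner, banach} \<Rightarrow> 's"
  assumes "positive_operator C"
  shows "positive_operator (op_sqrt C)" and "op_sqrt C (op_sqrt C x) = C x"
  using theI'[OF positive_sqrt_unique_exists[OF assms]] unfolding op_sqrt_def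
  by (auto simp: fun_eq_iff)

text \<open>Since \<open>C x\<close> is \<open>op_sqrt C\<close> applied to
  \<open>op_sqrt C x\<close>, its Cameron-Martin norm is \<open>norm (op_sqrt C x)\<close>. This
  removes the square root from the likelihood.\<close>

lemma ran_norm_op_sqrt:
  fixes C :: "'s::{real_inner, banach} \<Rightarrow> 's"
  assumes C: "positive_operator C" and "inj C"
  shows "(ran_norm (op_sqrt C) (C x))\<^sup>2 = x \<bullet> C x"
proof -
  note sq = op_sqrt[OF C]
  have "inj (op_sqrt C)" using \<open>inj C\<close> sq(2) by (metis injD injI)
  then have "ran_norm (op_sqrt C) (C x) = norm (op_sqrt C x)"
    by (simp add: ran_norm_def flip: sq(2))
  then show ?thesis
    using sq(1) by (simp add: power2_norm_eq_inner positive_operator_def sq(2))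
qed

section \<open>The covariance operator of Gaussian noise\<close>

text \<open>A non-integrable function has integral 0 by convention, so a vanishing second moment
  forces vanishing almost everywhere only together with integrability.\<close>

lemma gaussian_law_integrable_square:
  assumes "gaussian_law \<mu>"
  shows "integrable \<mu> (\<lambda>x. x\<^sup>2)"
  using assms unfolding gaussian_law_def
proof (elim disjE exE conjE)
  fix a assume "\<mu> = return borel a"
  then show ?thesis by (simp add: integrable_iff_bounded nn_integral_return)
next
  fix a \<sigma> :: real assume \<sigma>: "\<sigma> > 0"
    and \<mu>: "\<mu> = density lborel (\<lambda>x. ennreal (normal_density a \<sigma> x))"
  \<comment> \<open>Expansion about the mean; the exponents 1 and 0 stay visible to match the
    centred moment lemma.\<close>
  have eq: "normal_density a \<sigma> x *\<^sub>R x\<^sup>2 = normal_density a \<sigma> x * (x - a)^2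
      + 2 * a * (normal_density a \<sigma> x * (x - a)^1) + a\<^sup>2 * (normal_density a \<sigma> x * (x - a)^0)" for x
    by (simp add: power2_eq_square algebra_simps)
  have "integrable lborel (\<lambda>x. normal_density a \<sigma> x *\<^sub>R x\<^sup>2)"
    unfolding eq by (intro Bochner_Integration.integrable_add integrable_mult_right integrable_normal_moment \<sigma>)
  then show ?thesis unfolding \<mu> by (subst integrable_density) auto
qed

lemma covariance_operator_positive:
  assumes "covariance_operator M X C"
  shows "positive_operator C"
proof -
  have C: "bounded_linear C" "\<And>x y. (\<integral>\<omega>. (x \<bullet> X \<omega>) * (X \<omega> \<bullet> y) \<partial>M) = x \<bullet> C y"
    using assms by (auto simp: covariance_operator_def)
  have "C x \<bullet> y = x \<bullet> C y" for x y
    by (simp add: inner_commute mult.commute inner_commute[of "C x"] flip: C(2))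
  moreover have "0 \<le> x \<bullet> C x" for x
    by (simp add: inner_commute integral_nonneg_AE flip: C(2))
  ultimately show ?thesis using C(1) by (simp add: positive_operator_def)
qed

text \<open>If \<open>C x = 0\<close>, then \<open>x \<bullet> X \<omega>\<close> has second moment
  0 and vanishes almost everywhere. The open complement of the hyperplane orthogonal to
  \<open>x\<close> is thus null, the essential range lies in that closed hyperplane, and density
  forces \<open>x = 0\<close>.\<close>

lemma inj_covariance_operator:
  fixes X :: "'w \<Rightarrow> 's::{real_inner, second_countable_topology}"
  assumes X: "gaussian_rv M X" and cov: "covariance_operator M X C"
    and dense: "closure (essential_range M X) = UNIV"
  shows "inj C"
proof -
  have Xm [measurable]: "X \<in> borel_measurable M" using X by (simp add: gaussian_rv_def)
  interpret C: bounded_linear C using cov by (simp add: covariance_operator_def)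
  have "x = 0" if "C x = 0" for x
  proof -
    have "gaussian_law (distr M borel (\<lambda>\<omega>. x \<bullet> X \<omega>))" using X by (simp add: gaussian_rv_def)
    then have int: "integrable M (\<lambda>\<omega>. (x \<bullet> X \<omega>)\<^sup>2)"
      by (subst integrable_distr_eq[symmetric, where N = borel and f = "\<lambda>x. x\<^sup>2"])
        (auto intro: gaussian_law_integrable_square)
    have "(\<integral>\<omega>. (x \<bullet> X \<omega>)\<^sup>2 \<partial>M) = x \<bullet> C x"
      using cov by (simp add: covariance_operator_def power2_eq_square inner_commute)
    with that have "AE \<omega> in M. (x \<bullet> X \<omega>)\<^sup>2 = 0"
      using integral_nonneg_eq_0_iff_AE[OF int] by simp
    then have ae: "AE \<omega> in M. X \<omega> \<notin> {s. x \<bullet> s \<noteq> 0}" by simp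
    have op: "open {s. x \<bullet> s \<noteq> 0}"
      by (intro open_Collect_neq continuous_intros)
    have "measure M (X -` {s. x \<bullet> s \<noteq> 0} \<inter> space M) = 0"
    proof (rule measure_eq_0_null_sets)
      show "X -` {s. x \<bullet> s \<noteq> 0} \<inter> space M \<in> null_sets M"
        
        by (subst AE_iff_null_sets)
          (use ae measurable_sets[OF Xm borel_open[OF op]] in \<open>auto elim: eventually_mono\<close>)
    qed
    then have "essential_range M X \<subseteq> {s. x \<bullet> s = 0}"
      using op by (auto simp: essential_range_def)
    then have "closure (essential_range M X) \<subseteq> {s. x \<bullet> s = 0}"
      by (rule closure_minimal) (intro closed_Collect_eq continuous_intros)
    then have "x \<bullet> x = 0" using dense by blast
    then show "x = 0" by simp
  qed
  then show ?thesis unfolding inj_def by (metis C.diff right_minus_eq)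
qed

section \<open>Operators into and on a range with the transported norm\<close>

text \<open>Boundedness into \<open>range C\<close> with \<open>ran_norm C\<close> becomes ordinary
  boundedness after inverting \<open>C\<close>; linearity is checked after applying the injective
  \<open>C\<close>.\<close>

lemma bounded_linear_inv_comp:
  assumes C: "linear C" and "inj C" and B: "linear B" "range B \<subseteq> range C"
    and K: "\<And>y. ran_norm C (B y) \<le> K * norm y"
  shows "bounded_linear (\<lambda>y. inv C (B y))"
proof (rule bounded_linear_intro[where K = K])
  have CB: "C (inv C (B y)) = B y" for y using B(2) by (intro f_inv_into_f) auto
  show "inv C (B (x + y)) = inv C (B x) + inv C (B y)" for x y
    by (rule injD[OF \<open>inj C\<close>]) (simp add: CB linear_add[OF C] flip: linear_add[OF B(1)])
  show "inv C (B (r *\<^sub>R x)) = r *\<^sub>R inv C (B x)" for r x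
    by (rule injD[OF \<open>inj C\<close>]) (simp add: CB linear_scale[OF C] flip: linear_scale[OF B(1)])
  show "norm (inv C (B y)) \<le> norm y * K" for y
    using K[of y] by (simp add: ran_norm_def mult.commute)
qed

text \<open>A real supremum dominates its members only if the set is bounded above, which the
  constant in \<open>bounded_linear_on_ran\<close> provides. At \<open>z = 0\<close> the quotient
  carries no information, so \<open>P 0 = 0\<close> is used.\<close>

lemma ran_norm_le_ran_onorm:
  assumes P: "bounded_linear_on_ran D P" and z: "z \<in> range D" and D: "linear D" "inj D"
  shows "ran_norm D (P z) \<le> ran_onorm D P * ran_norm D z"
proof (cases "z = 0")
  case True
  have "P 0 = P (0 *\<^sub>R z)" by simp
  also have "\<dots> = 0 *\<^sub>R P z" using P z unfolding bounded_linear_on_ran_def by blast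
  also have "\<dots> = 0" by simp
  finally show ?thesis
    using inv_f_f[OF D(2), of 0] by (simp add: True ran_norm_def linear_0[OF D(1)])
next
  case False
  obtain K where K: "\<And>x. x \<in> range D \<Longrightarrow> ran_norm D (P x) \<le> K * ran_norm D x"
    using P unfolding bounded_linear_on_ran_def by blast
  have nonneg: "ran_norm D x \<ge> 0" for x by (simp add: ran_norm_def)
  have pos: "ran_norm D z > 0"
    using z False D by (auto simp: ran_norm_def linear_0)
  \<comment> \<open>The absolute value covers a possibly negative \<open>K\<close>; a zero
    denominator makes the quotient 0.\<close>
  have "ran_norm D (P x) / ran_norm D x \<le> \<bar>K\<bar>" if "x \<in> range D" for x
  proof (cases "ran_norm D x = 0")
    case False
    have "ran_norm D (P x) \<le> \<bar>K\<bar> * ran_norm D x"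
      using K[OF that] mult_right_mono[OF abs_ge_self[of K] nonneg[of x]] by simp
    then show ?thesis using False nonneg[of x] by (simp add: divide_le_eq)
  qed simp
  then have "bdd_above ((\<lambda>x. ran_norm D (P x) / ran_norm D x) ` range D)"
    by (intro bdd_aboveI2[where M = "\<bar>K\<bar>"]) auto
  then have "ran_norm D (P z) / ran_norm D z \<le> ran_onorm D P"
    unfolding ran_onorm_def by (rule cSUP_upper[OF z])
  then show ?thesis using pos by (simp add: divide_le_eq)
qed

section \<open>Double limits along sequences\<close>

text \<open>If the double limit fails, then for some \<open>e\<close> every \<open>N\<close> admits
  a bad pair with both indices at least \<open>N\<close>; these pairs form sequences contradicting
  the assumption.\<close>

lemma tendsto_prod_sequentiallyI:
  fixes f :: "nat \<times> nat \<Rightarrow> 'a::metric_space"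
  assumes "\<And>p q. filterlim p sequentially sequentially \<Longrightarrow> filterlim q sequentially sequentially
    \<Longrightarrow> (\<lambda>j. f (p j, q j)) \<longlonglongrightarrow> l"
  shows "(f \<longlongrightarrow> l) (sequentially \<times>\<^sub>F sequentially)"
proof (rule ccontr)
  assume "\<not> ?thesis"
  then obtain e where e: "e > 0" "\<And>N. \<exists>m\<ge>N. \<exists>n\<ge>N. \<not> dist (f (n, m)) l < e"
    unfolding tendsto_iff eventually_prod_sequentially by blast
  from e(2) obtain p q where pq: "\<And>N. q N \<ge> N \<and> p N \<ge> N \<and> \<not> dist (f (p N, q N)) l < e"
    by metis
  have "filterlim p sequentially sequentially" "filterlim q sequentially sequentially"
    using pq by (auto intro!: filterlim_at_top_mono[OF filterlim_ident])
  from tendstoD[OF assms[OF this] e(1)] pq show False by auto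
qed

section \<open>Likelihoods and dominated convergence\<close>

lemma likelihood_eq:
  fixes C :: "'s::{real_inner, banach} \<Rightarrow> 's"
  assumes "positive_operator C" "inj C" and "B u \<in> range C"
  shows "likelihood C B m u = exp (- (1 / 2) * (inv C (B u) \<bullet> C (inv C (B u))) + inv C (B u) \<bullet> m)"
  using ran_norm_op_sqrt[OF assms(1,2), of "inv C (B u)"] assms(3)
  by (simp add: likelihood_def f_inv_into_f)

lemma continuous_on_likelihood:
  fixes C :: "'s::{real_inner, banach} \<Rightarrow> 's"
  assumes C: "positive_operator C" "inj C" and B: "range B \<subseteq> range C"
    and L: "bounded_linear (\<lambda>y. inv C (B y))"
  shows "continuous_on S (likelihood C B m)"
proof -
  have bC: "bounded_linear C" using C(1) by (simp add: positive_operator_def)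
  note [continuous_intros] = bounded_linear.continuous_on[OF L continuous_on_id]
    bounded_linear.continuous_on[OF bC]
  have "likelihood C B m = (\<lambda>u. exp (- (1 / 2) * (inv C (B u) \<bullet> C (inv C (B u))) + inv C (B u) \<bullet> m))"
    by (intro ext likelihood_eq C) (use B in blast)
  then show ?thesis by (simp only:) (intro continuous_intros)
qed

text \<open>Numerators and denominators are the cases \<open>h = g\<close> and \<open>h = 1\<close>.
  Letting operators, projections and data all vary with \<open>j\<close> covers every limit, frozen
  indices being constant sequences.\<close>

lemma integral_likelihood_tendsto:
  fixes U :: "'w \<Rightarrow> 'y::{real_normed_vector, second_countable_topology}"
    and C :: "'s::{real_inner, banach} \<Rightarrow> 's"
    and h :: "'y \<Rightarrow> real"
  assumes U [measurable]: "U \<in> borel_measurable M"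
    and exp_int: "\<And>l::real. l > 0 \<Longrightarrow> integrable M (\<lambda>\<omega>. exp (l * norm (U \<omega>)))"
    and h: "continuous_on UNIV h" "\<And>u. \<bar>h u\<bar> \<le> a * exp (a * norm u)"
    and C: "positive_operator C" "inj C"
    and B: "\<And>j. range (B j) \<subseteq> range C" "\<And>j. bounded_linear (\<lambda>y. inv C (B j y))"
      "\<And>j y. norm (inv C (B j y)) \<le> K * norm y"
    and B': "range B' \<subseteq> range C" "bounded_linear (\<lambda>y. inv C (B' y))"
    and Blim: "\<And>y. (\<lambda>j. inv C (B j y)) \<longlonglongrightarrow> inv C (B' y)"
    and T: "\<And>j. bounded_linear (T j)" "\<And>j y. norm (T j y) \<le> K' * norm y"
    and T': "bounded_linear T'"
    and Tlim: "\<And>y. (\<lambda>j. T j y) \<longlonglongrightarrow> T' y"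
    and ms: "ms \<longlonglongrightarrow> m"
  shows "(\<lambda>j. \<integral>u. h u * likelihood C (B j) (ms j) u \<partial>distr M borel (T j \<circ> U))
      \<longlonglongrightarrow> (\<integral>u. h u * likelihood C B' m u \<partial>distr M borel (T' \<circ> U))" (is ?lim)
    and "integrable (distr M borel (T' \<circ> U)) (\<lambda>u. h u * likelihood C B' m u)" (is ?int)
proof -
  have K: "0 \<le> \<bar>K\<bar>" "0 \<le> \<bar>K'\<bar>" by auto
  have BK: "norm (inv C (B j y)) \<le> \<bar>K\<bar> * norm y" for j y
    using B(3)[of j y] mult_right_mono[OF abs_ge_self[of K] norm_ge_zero[of y]] by simp
  have TK: "norm (T j y) \<le> \<bar>K'\<bar> * norm y" for j y
    using T(2)[of j y] mult_right_mono[OF abs_ge_self[of K'] norm_ge_zero[of y]] by simp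
  have a: "0 \<le> a" using h(2)[of 0] by simp
  obtain S where S: "S > 0" "\<And>j. norm (ms j) \<le> S"
    using convergent_imp_Bseq[OF convergentI[OF ms]] by (auto simp: Bseq_def)
  have meas: "V \<in> borel_measurable M" 
    if "bounded_linear F" "V = F \<circ> U" for V and F :: "'y \<Rightarrow> 'y"
    using borel_measurable_continuous_onI[OF bounded_linear.continuous_on[OF that(1) continuous_on_id]]
    unfolding that(2) by (simp add: U measurable_comp[where N = borel])
  note mT = meas[OF T(1) refl] meas[OF T' refl]
  have mh: "(\<lambda>u. h u * likelihood C (B j) (ms j) u) \<in> borel_measurable borel"
    "(\<lambda>u. h u * likelihood C B' m u) \<in> borel_measurable borel" for j
    by (auto intro!: borel_measurable_continuous_onI continuous_on_mult h(1)
        continuous_on_likelihood C B B')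
  \<comment> \<open>Two moving operators: the uniform bound \<open>K\<close> absorbs the change from
    \<open>T j y\<close> to \<open>T' y\<close>, and pointwise convergence at \<open>T' y\<close>
    does the rest.\<close>
  have xlim: "(\<lambda>j. inv C (B j (T j y))) \<longlonglongrightarrow> inv C (B' (T' y))" for y
  proof -
    have le: "norm (inv C (B j (T j y)) - inv C (B j (T' y))) \<le> \<bar>K\<bar> * norm (T j y - T' y)" for j
      using BK[of j "T j y - T' y"] by (simp add: linear_diff[OF bounded_linear.linear[OF B(2)]])
    have "(\<lambda>j. \<bar>K\<bar> * norm (T j y - T' y)) \<longlonglongrightarrow> 0"
      using tendsto_mult_right_zero[OF tendsto_norm_zero[OF LIM_zero[OF Tlim[of y]]]] by simp
    then have "(\<lambda>j. inv C (B j (T j y)) - inv C (B j (T' y))) \<longlonglongrightarrow> 0"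
      by (rule Lim_null_comparison[OF always_eventually[OF allI[OF le]]])
    from tendsto_add[OF this Blim[of "T' y"]] show ?thesis by simp
  qed
  have Clim: "(\<lambda>j. C (inv C (B j (T j y)))) \<longlonglongrightarrow> C (inv C (B' (T' y)))" for y
    using C(1) xlim by (auto simp: positive_operator_def intro: bounded_linear.tendsto)
  have hlim: "(\<lambda>j. h (T j y)) \<longlonglongrightarrow> h (T' y)" for y
    by (rule continuous_on_tendsto_compose[OF h(1) Tlim]) auto
  have lik: "likelihood C (B j) s u = exp (- (1 / 2) * (inv C (B j u) \<bullet> C (inv C (B j u))) + inv C (B j u) \<bullet> s)"
    "likelihood C B' s u = exp (- (1 / 2) * (inv C (B' u) \<bullet> C (inv C (B' u))) + inv C (B' u) \<bullet> s)" for j s u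
    using B(1)[of j] B'(1) by (intro likelihood_eq C; blast)+
  have lim: "(\<lambda>j. h (T j y) * likelihood C (B j) (ms j) (T j y)) \<longlonglongrightarrow> h (T' y) * likelihood C B' m (T' y)" for y
    unfolding lik by (intro tendsto_intros hlim xlim Clim ms)
  \<comment> \<open>The growth rate of \<open>h\<close> along \<open>T j\<close> plus that of the
    likelihood; the final 1 ensures \<open>l > 0\<close>, as \<open>exp_int\<close> demands.\<close>
  define l where "l = a * \<bar>K'\<bar> + \<bar>K\<bar> * \<bar>K'\<bar> * S + 1"
  have l: "l > 0" using a S(1) by (simp add: l_def add_nonneg_pos)
  have bound: "norm (h (T j y) * likelihood C (B j) (ms j) (T j y)) \<le> a * exp (l * norm y)" for j y
  proof -
    have "inv C (B j (T j y)) \<bullet> ms j \<le> norm (inv C (B j (T j y))) * norm (ms j)"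
      by (rule norm_cauchy_schwarz)
    also have "\<dots> \<le> (\<bar>K\<bar> * (\<bar>K'\<bar> * norm y)) * S"
      using order_trans[OF BK[of j "T j y"] mult_left_mono[OF TK[of j y] K(1)]] S
      by (intro mult_mono) auto
    finally have "inv C (B j (T j y)) \<bullet> ms j \<le> \<bar>K\<bar> * \<bar>K'\<bar> * S * norm y"
      by (simp add: mult_ac)
    \<comment> \<open>The quadratic part only decreases the exponent, leaving the linear
      term.\<close>
    moreover have "0 \<le> inv C (B j (T j y)) \<bullet> C (inv C (B j (T j y)))"
      using C(1) by (simp add: positive_operator_def)
    ultimately have "likelihood C (B j) (ms j) (T j y) \<le> exp (\<bar>K\<bar> * \<bar>K'\<bar> * S * norm y)"
      unfolding lik by simp
    moreover have "\<bar>h (T j y)\<bar> \<le> a * exp (a * (\<bar>K'\<bar> * norm y))"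
      by (rule order_trans[OF h(2)]) (use a TK[of j y] in \<open>auto intro!: mult_left_mono\<close>)
    ultimately have "\<bar>h (T j y)\<bar> * likelihood C (B j) (ms j) (T j y)
        \<le> (a * exp (a * (\<bar>K'\<bar> * norm y))) * exp (\<bar>K\<bar> * \<bar>K'\<bar> * S * norm y)"
      using a by (intro mult_mono) (auto simp: likelihood_def)
    also have "\<dots> = a * exp ((l - 1) * norm y)"
      by (simp add: l_def mult.assoc distrib_right flip: exp_add)
    also have "\<dots> \<le> a * exp (l * norm y)"
      using a by (intro mult_left_mono) (auto intro: mult_right_mono)
    finally show ?thesis by (simp add: abs_mult likelihood_def)
  qed
  have w: "integrable M (\<lambda>\<omega>. a * exp (l * norm (U \<omega>)))"
    using exp_int[OF l] by simp
  have mc: "(\<lambda>\<omega>. h (T' (U \<omega>)) * likelihood C B' m (T' (U \<omega>))) \<in> borel_measurable M"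
    "(\<lambda>\<omega>. h (T j (U \<omega>)) * likelihood C (B j) (ms j) (T j (U \<omega>))) \<in> borel_measurable M" for j
    using measurable_compose[OF mT(2) mh(2)] measurable_compose[OF mT(1) mh(1)] by (simp_all add: o_def)
  have "(\<lambda>j. \<integral>\<omega>. h (T j (U \<omega>)) * likelihood C (B j) (ms j) (T j (U \<omega>)) \<partial>M)
      \<longlonglongrightarrow> (\<integral>\<omega>. h (T' (U \<omega>)) * likelihood C B' m (T' (U \<omega>)) \<partial>M)"
    by (rule integral_dominated_convergence[OF mc w]) (use lim bound in auto)
  then show ?lim
    by (simp add: integral_distr[OF mT(1) mh(1)] integral_distr[OF mT(2) mh(2)])
  have "integrable M (\<lambda>\<omega>. h (T' (U \<omega>)) * likelihood C B' m (T' (U \<omega>)))"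
    by (rule integrable_dominated_convergence[OF mc w, where j1 = "\<lambda>j. j"]) (use lim bound in auto)
  then show ?int
    by (subst integrable_distr_eq[OF mT(2) mh(2)]) simp
qed

text \<open>Numerator and denominator converge separately; the quotient converges because the
  limiting denominator integrates a strictly positive function against a probability
  measure.\<close>

lemma reconstructor_tendsto:
  fixes U :: "'w \<Rightarrow> 'y::{real_normed_vector, second_countable_topology}"
    and C :: "'s::{real_inner, banach} \<Rightarrow> 's"
    and g :: "'y \<Rightarrow> real"
  assumes M: "prob_space M" and U: "U \<in> borel_measurable M"
    and exp_int: "\<And>l::real. l > 0 \<Longrightarrow> integrable M (\<lambda>\<omega>. exp (l * norm (U \<omega>)))"
    and g: "continuous_on UNIV g" "\<And>u. \<bar>g u\<bar> \<le> a * exp (a * norm u)"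
    and C: "positive_operator C" "inj C"
    and B: "\<And>j. range (B j) \<subseteq> range C" "\<And>j. bounded_linear (\<lambda>y. inv C (B j y))"
      "\<And>j y. norm (inv C (B j y)) \<le> K * norm y"
    and B': "range B' \<subseteq> range C" "bounded_linear (\<lambda>y. inv C (B' y))"
    and Blim: "\<And>y. (\<lambda>j. inv C (B j y)) \<longlonglongrightarrow> inv C (B' y)"
    and T: "\<And>j. bounded_linear (T j)" "\<And>j y. norm (T j y) \<le> K' * norm y"
    and T': "bounded_linear T'"
    and Tlim: "\<And>y. (\<lambda>j. T j y) \<longlonglongrightarrow> T' y"
    and ms: "ms \<longlonglongrightarrow> m"
  shows "(\<lambda>j. reconstructor M C (B j) (T j \<circ> U) g (ms j)) \<longlonglongrightarrow> reconstructor M C B' (T' \<circ> U) g m"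
proof -
  note rest = C B B' Blim T T' Tlim ms
  have one: "continuous_on UNIV (\<lambda>u::'y. 1 :: real)" "\<And>u::'y. \<bar>1::real\<bar> \<le> 1 * exp (1 * norm u)"
    by auto
  note num = integral_likelihood_tendsto(1)[OF U exp_int g rest]
  note den = integral_likelihood_tendsto[OF U exp_int one rest, simplified]
  define N where "N = distr M borel (T' \<circ> U)"
  have "T' \<in> borel_measurable borel"
    by (intro borel_measurable_continuous_onI bounded_linear.continuous_on[OF T'] continuous_on_id)
  then interpret N: prob_space N
    unfolding N_def by (intro prob_space.prob_space_distr[OF M] measurable_comp[OF U])
  have nz: "(\<integral>u. likelihood C B' m u \<partial>N) \<noteq> 0"
  proof
    assume "(\<integral>u. likelihood C B' m u \<partial>N) = 0"
    moreover have pos: "likelihood C B' m u > 0" for u by (simp add: likelihood_def)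
    ultimately have "AE u in N. likelihood C B' m u = 0"
      unfolding N_def using integral_nonneg_eq_0_iff_AE[OF den(2)] by (simp add: less_imp_le)
    then have "AE u in N. False" by (rule eventually_mono) (use pos in \<open>simp add: less_le\<close>)
    then show False by simp
  qed
  show ?thesis
    unfolding reconstructor_def by (intro tendsto_divide num den(1) nz[unfolded N_def])
qed

section \<open>The joint limit and the two iterated limits\<close>

theorem theorem5:
  fixes M :: "'w measure"
    and U :: "'w \<Rightarrow> 'y::{banach, second_countable_topology}"
    and \<E> :: "'w \<Rightarrow> 's::{real_inner, banach, second_countable_topology}"
    and C :: "'s \<Rightarrow> 's"
    and A :: "'y \<Rightarrow> 's"
    and g :: "'y \<Rightarrow> real"
    and a C\<^sub>0 :: real
    and T :: "nat \<Rightarrow> 'y \<Rightarrow> 'y"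
    and P :: "nat \<Rightarrow> 's \<Rightarrow> 's"
    and ms :: "nat \<Rightarrow> 's"
    and m :: 's
  assumes "prob_space M" and "complete_measure M"
    and "U \<in> borel_measurable M"
    and "gaussian_rv M \<E>"
    and "independent_rvs M U \<E>"
    and "has_bochner_integral M \<E> 0"
    and "covariance_operator M \<E> C"
    and "closure (essential_range M \<E>) = UNIV"
    and "bounded_linear_into_ran C A"
    and "\<And>l::real. l > 0 \<Longrightarrow> integrable M (\<lambda>\<omega>. exp (l * norm (U \<omega>)))"
    and "continuous_on UNIV g"
    and "\<And>u. \<bar>g u\<bar> \<le> a * exp (a * norm u)"
    and "\<And>n. bounded_linear (T n)" and "\<And>n. T n \<circ> T n = T n"
    and "\<And>k. bounded_linear_on_ran C (P k)"
    and "\<And>k z. z \<in> range C \<Longrightarrow> P k (P k z) = P k z"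
    and "\<And>y. (\<lambda>n. norm (T n y - y)) \<longlonglongrightarrow> 0"
    and "\<And>z. z \<in> range A \<Longrightarrow> (\<lambda>k. ran_norm C (P k z - z)) \<longlonglongrightarrow> 0"
    and "C\<^sub>0 > 0"
    and "\<And>n. onorm (T n) \<le> C\<^sub>0"
    and "\<And>k. ran_onorm C (P k) \<le> C\<^sub>0"
    and "ms \<longlonglongrightarrow> m"
  shows "((\<lambda>(n, k). reconstructor M C (P k \<circ> A) (T n \<circ> U) g (ms k)) \<longlongrightarrow>
            reconstructor M C A U g m) (sequentially \<times>\<^sub>F sequentially)
    \<and> (\<forall>k. convergent (\<lambda>n. reconstructor M C (P k \<circ> A) (T n \<circ> U) g (ms k)))
    \<and> (\<forall>n. convergent (\<lambda>k. reconstructor M C (P k \<circ> A) (T n \<circ> U) g (ms k)))"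
proof -
  note M = assms(1) and U = assms(3) and X = assms(4) and cov = assms(7) and dense = assms(8)
    and A = assms(9) and exp_int = assms(10) and g = assms(11,12) and T = assms(13)
    and P = assms(15) and Tlim = assms(17) and Plim = assms(18) and ms = assms(22)
  have C: "positive_operator C" "inj C"
    using covariance_operator_positive[OF cov] inj_covariance_operator[OF X cov dense] by auto
  then have linC: "linear C" by (simp add: positive_operator_def bounded_linear.linear)
  obtain K where linA: "linear A" and ranA: "range A \<subseteq> range C"
    and K: "\<And>y. ran_norm C (A y) \<le> K * norm y"
    using A by (auto simp: bounded_linear_into_ran_def)
  have PA_ran: "range (P k \<circ> A) \<subseteq> range C" for k
  proof -
    have "range (P k \<circ> A) = P k ` range A" by (rule image_comp[symmetric])
    also have "\<dots> \<subseteq> P k ` range C" by (rule image_mono[OF ranA])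
    also have "\<dots> \<subseteq> range C" using P[of k] unfolding bounded_linear_on_ran_def by (rule conjunct1)
    finally show ?thesis .
  qed
  \<comment> \<open>Uniformity in \<open>k\<close> comes from the common bound on
    \<open>ran_onorm C (P k)\<close>.\<close>
  have PA_bound: "ran_norm C ((P k \<circ> A) y) \<le> (C\<^sub>0 * K) * norm y" for k y
  proof -
    have "ran_norm C (P k (A y)) \<le> ran_onorm C (P k) * ran_norm C (A y)"
      by (rule ran_norm_le_ran_onorm[OF P _ linC C(2)]) (use ranA in blast)
    also have "\<dots> \<le> C\<^sub>0 * (K * norm y)"
      using assms(19) assms(21)[of k] K[of y] by (intro mult_mono) (auto simp: ran_norm_def)
    finally show ?thesis by (simp add: mult.assoc)
  qed
  have PA_lin: "linear (P k \<circ> A)" for k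
  proof (rule linearI)
    have AC: "A y \<in> range C" for y using ranA by blast
    note Pk = P[of k, unfolded bounded_linear_on_ran_def]
    have P_add: "\<forall>x\<in>range C. \<forall>y\<in>range C. P k (x + y) = P k x + P k y"
      by (rule Pk[THEN conjunct2, THEN conjunct1])
    have P_scale: "\<forall>c. \<forall>x\<in>range C. P k (c *\<^sub>R x) = c *\<^sub>R P k x"
      by (rule Pk[THEN conjunct2, THEN conjunct2, THEN conjunct1])
    show "(P k \<circ> A) (x + y) = (P k \<circ> A) x + (P k \<circ> A) y" for x y
      using P_add[rule_format, OF AC AC] by (simp add: linear_add[OF linA])
    show "(P k \<circ> A) (c *\<^sub>R x) = c *\<^sub>R (P k \<circ> A) x" for c x
      using P_scale[rule_format, OF AC] by (simp add: linear_scale[OF linA])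
  qed
  note LA = bounded_linear_inv_comp[OF linC C(2) linA ranA K]
  note LPA = bounded_linear_inv_comp[OF linC C(2) PA_lin PA_ran PA_bound]
  have LPA_bound: "norm (inv C ((P k \<circ> A) y)) \<le> (C\<^sub>0 * K) * norm y" for k y
    using PA_bound by (simp add: ran_norm_def)
  have LPA_lim: "(\<lambda>k. inv C ((P k \<circ> A) y)) \<longlonglongrightarrow> inv C (A y)" for y
  proof (rule LIM_zero_cancel, rule tendsto_norm_zero_cancel)
    \<comment> \<open>On \<open>range C\<close> the inverse is additive, so convergence in
      \<open>ran_norm C\<close> is norm convergence of the preimages.\<close>
    have "inv C (P k (A y) - A y) = inv C ((P k \<circ> A) y) - inv C (A y)" for k
    proof (rule inv_f_eq[OF C(2)])
      have "P k (A y) \<in> range C" "A y \<in> range C" using PA_ran[of k] ranA by auto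
      then show "C (inv C ((P k \<circ> A) y) - inv C (A y)) = P k (A y) - A y"
        by (simp add: linear_diff[OF linC] f_inv_into_f)
    qed
    then show "(\<lambda>k. norm (inv C ((P k \<circ> A) y) - inv C (A y))) \<longlonglongrightarrow> 0"
      using Plim[of "A y"] by (simp add: ran_norm_def)
  qed
  have T_bound: "norm (T n y) \<le> C\<^sub>0 * norm y" for n y
    using onorm[OF T[of n], of y] mult_right_mono[OF assms(20)[of n] norm_ge_zero[of y]] by simp
  have T_lim: "(\<lambda>n. T n y) \<longlonglongrightarrow> y" for y
    by (rule LIM_zero_cancel, rule tendsto_norm_zero_cancel, rule Tlim)
  \<comment> \<open>The limit of the projections is the identity, so the limiting variable first
    appears as \<open>(\<lambda>y. y) \<circ> U\<close>.\<close>
  have joint: "(\<lambda>j. reconstructor M C (P (q j) \<circ> A) (T (p j) \<circ> U) g (ms (q j)))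
      \<longlonglongrightarrow> reconstructor M C A ((\<lambda>y. y) \<circ> U) g m"
    if pq: "filterlim p sequentially sequentially" "filterlim q sequentially sequentially" for p q
    by (rule reconstructor_tendsto[OF M U exp_int g C PA_ran LPA LPA_bound ranA LA
          filterlim_compose[OF LPA_lim pq(2)] T T_bound bounded_linear_ident
          filterlim_compose[OF T_lim pq(1)] filterlim_compose[OF ms pq(2)]])
  \<comment> \<open>With \<open>k\<close> frozen, the operator \<open>P k \<circ> A\<close> and the
    data \<open>ms k\<close> are constant sequences.\<close>
  have "(\<lambda>n. reconstructor M C (P k \<circ> A) (T n \<circ> U) g (ms k))
      \<longlonglongrightarrow> reconstructor M C (P k \<circ> A) ((\<lambda>y. y) \<circ> U) g (ms k)" for k
    by (rule reconstructor_tendsto[OF M U exp_int g C PA_ran LPA LPA_bound PA_ran LPA tendsto_const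
          T T_bound bounded_linear_ident T_lim tendsto_const])
  \<comment> \<open>With \<open>n\<close> frozen, \<open>T n\<close> serves as both the sequence and
    its limit.\<close>
  moreover have "(\<lambda>k. reconstructor M C (P k \<circ> A) (T n \<circ> U) g (ms k))
      \<longlonglongrightarrow> reconstructor M C A (T n \<circ> U) g m" for n
    by (rule reconstructor_tendsto[OF M U exp_int g C PA_ran LPA LPA_bound ranA LA LPA_lim
          T T_bound T tendsto_const ms])
  ultimately show ?thesis
    using joint by (intro conjI allI tendsto_prod_sequentiallyI) (auto intro: convergentI simp: o_def)
qed

end
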